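(* Consider the signal $$s(x)=s(x,a,f)=\cos(2\pi x)+a\cos(2\pi f x+\phi),\qquad x\in\mathbb{R},\ f\in(0,1),$$ whose first term is called the high frequency (HF) component and whose second term is called the low frequency (LF) component. Assume that the Iterative Filtering (IF) method selects accurately the mask length $L$ of the doubly convolved filter $w_L$, so that the lowest positive frequency at which $\widehat{w_L}$ has zero value is frequency $1$. Then the IF algorithm in the continuous setting can always resolve the signal $s$ into two components, no matter how close the frequency $f$ of the LF component is to $1$.
   Context: A filter (window) is a nonnegative, even, continuous function $w$ compactly supported in $[-L,L]$, $L>0$, with $\int_{\mathbb{R}}w(z)\,dz=1$; $L$ is called the filter length (or mask length). A filter is doubly convolved if it is the convolution $h\ast h$ of a nonnegative, symmetric, compactly supported function $h$ with $\int_{\mathbb{R}} h(z)\,dz=1$ with itself. The filter $w_L$ supported on $[-L,L]$ is obtained from an a priori fixed filter shape $w:[-1,1]\to\mathbb{R}$ by the linear scaling $w_L(x)=\frac1L w\left(\frac xL\right)$. The Fourier transform is $\widehat{w}(\xi)=\int_{-\infty}^{+\infty}w(x)e^{-2\pi i\xi x}\,dx$. Iterative Filtering (continuous setting): in the inner loop, with filter length $L$ selected at the first step and then kept constant, one sets $s_1=s$ and $s_{m+1}=\mathcal{M}(s_m)$, where $\mathcal{M}(g)(x)=g(x)-\int_{-L}^{L}g(x+t)w_L(t)\,dt$. The first extracted component (intrinsic mode function) is $\mathrm{IMF}_1=\lim_{m\to\infty}\mathcal{M}^m(s)$. The outer loop applies the same procedure to the remainder $s-\mathrm{IMF}_1$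 to produce the subsequent components, until the remainder has at most one local extremum. *)

theory Defs
  imports "HOL-Analysis.Analysis"
begin

text \<open>A filter on \<open>[-L,L]\<close> is a function on the whole line that vanishes outside
  \<open>[-L,L]\<close>.  As it is continuous on the line, it also vanishes at \<open>L\<close> and \<open>-L\<close>.\<close>

definition filter_window :: "(real \<Rightarrow> real) \<Rightarrow> real \<Rightarrow> bool" where
  "filter_window w L \<longleftrightarrow>
     0 < L \<and>
     (\<forall>x. 0 \<le> w x) \<and>
     (\<forall>x. w (- x) = w x) \<and>
     continuous_on UNIV w \<and>
     (\<forall>x. x \<notin> {-L..L} \<longrightarrow> w x = 0) \<and>
     (LBINT x. w x) = 1"

definition scaled_filter :: "(real \<Rightarrow> real) \<Rightarrow> real \<Rightarrow> real \<Rightarrow> real" where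
  "scaled_filter w L x = (1 / L) * w (x / L)"

text \<open>No continuity is required of \<open>h\<close> (the indicator of an interval, suitably normalised, is
  the standard example).  The fifth conjunct says that the convolution integral exists at every
  point; without it the Bochner integral would silently take the value 0.\<close>

definition doubly_convolved :: "(real \<Rightarrow> real) \<Rightarrow> bool" where
  "doubly_convolved w \<longleftrightarrow>
     (\<exists>h :: real \<Rightarrow> real.
        (\<forall>x. 0 \<le> h x) \<and>
        (\<forall>x. h (- x) = h x) \<and>
        compact (closure {x. h x \<noteq> 0}) \<and>
        integrable lborel h \<and>
        (\<forall>x. integrable lborel (\<lambda>t. h t * h (x - t))) \<and>
        (LBINT x. h x) = 1 \<and>
        (\<forall>x. w x = (LBINT t. h t * h (x - t))))"

definition fourier_transform :: "(real \<Rightarrow> real) \<Rightarrow> real \<Rightarrow> complex" where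
  "fourier_transform w \<xi> =
     (LBINT x. complex_of_real (w x) * exp (- 2 * complex_of_real pi * \<i> * complex_of_real \<xi> * complex_of_real x))"

definition lowest_zero_frequency :: "(real \<Rightarrow> real) \<Rightarrow> real \<Rightarrow> bool" where
  "lowest_zero_frequency w \<nu> \<longleftrightarrow>
     0 < \<nu> \<and> fourier_transform w \<nu> = 0 \<and>
     (\<forall>\<xi>. 0 < \<xi> \<and> \<xi> < \<nu> \<longrightarrow> fourier_transform w \<xi> \<noteq> 0)"

definition sift :: "(real \<Rightarrow> real) \<Rightarrow> real \<Rightarrow> (real \<Rightarrow> real) \<Rightarrow> real \<Rightarrow> real" where
  "sift w L g x = g x - (LBINT t:{-L..L}. g (x + t) * scaled_filter w L t)"

text \<open>The inner loop.  The limit of the sifting iterates is taken in the supremum norm on the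
  line; in particular it is also the pointwise limit, and hence unique.\<close>

definition has_IMF :: "(real \<Rightarrow> real) \<Rightarrow> real \<Rightarrow> (real \<Rightarrow> real) \<Rightarrow> (real \<Rightarrow> real) \<Rightarrow> bool" where
  "has_IMF w L s g \<longleftrightarrow> uniform_limit UNIV (\<lambda>m. (sift w L ^^ m) s) g sequentially"

text \<open>Extrema are strict, so that constant functions have none.\<close>

definition local_extremum :: "(real \<Rightarrow> real) \<Rightarrow> real \<Rightarrow> bool" where
  "local_extremum g x \<longleftrightarrow>
     (\<forall>\<^sub>F y in at x. g y < g x) \<or> (\<forall>\<^sub>F y in at x. g x < g y)"

definition at_most_one_extremum :: "(real \<Rightarrow> real) \<Rightarrow> bool" where
  "at_most_one_extremum g \<longleftrightarrow>
     (\<forall>x y. local_extremum g x \<and> local_extremum g y \<longrightarrow> x = y)"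

text \<open>The outer loop: \<open>IF_run w s Ls gs r\<close> says that Iterative Filtering with filter shape
  \<open>w\<close>, selecting successively the mask lengths \<open>Ls\<close>, extracts from \<open>s\<close> precisely the
  components \<open>gs\<close> and then stops with remainder \<open>r\<close>.  The stopping test is applied to the
  remainder after each extraction.\<close>

inductive IF_run ::
  "(real \<Rightarrow> real) \<Rightarrow> (real \<Rightarrow> real) \<Rightarrow> real list \<Rightarrow> (real \<Rightarrow> real) list \<Rightarrow> (real \<Rightarrow> real) \<Rightarrow> bool"
  for w :: "real \<Rightarrow> real" where
  stop: "0 < L \<Longrightarrow> has_IMF w L s g \<Longrightarrow> r = (\<lambda>x. s x - g x) \<Longrightarrow>
         at_most_one_extremum r \<Longrightarrow> IF_run w s [L] [g] r"
| continue: "0 < L \<Longrightarrow> has_IMF w L s g \<Longrightarrow> r = (\<lambda>x. s x - g x) \<Longrightarrow>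
         \<not> at_most_one_extremum r \<Longrightarrow> IF_run w r Ls gs r' \<Longrightarrow> IF_run w s (L # Ls) (g # gs) r'"

definition HF :: "real \<Rightarrow> real" where
  "HF x = cos (2 * pi * x)"

definition LF :: "real \<Rightarrow> real \<Rightarrow> real \<Rightarrow> real \<Rightarrow> real" where
  "LF a f \<phi> x = a * cos (2 * pi * f * x + \<phi>)"

definition two_tone_signal :: "real \<Rightarrow> real \<Rightarrow> real \<Rightarrow> real \<Rightarrow> real" where
  "two_tone_signal a f \<phi> x = cos (2 * pi * x) + a * cos (2 * pi * f * x + \<phi>)"

end

theory Submission
  imports Defs
begin

text \<open>Convolution with an even filter multiplies a tone of frequency \<open>\<nu>\<close> by the value of the
  Fourier transform at \<open>\<nu>\<close>, so \<open>m\<close> sifting steps multiply it by the \<open>m\<close>-th power of one minus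
  that value.  For a doubly convolved filter the transform is the square of the real transform of
  \<open>h\<close>, hence nonnegative; below its first zero it is therefore positive, and it is at most 1.
  The tone at the first zero is thus unchanged while every lower tone decays geometrically.\<close>

section \<open>Fourier transforms of even and of doubly convolved functions\<close>

text \<open>A real-valued stand-in for \<open>fourier_transform\<close>, with which it agrees on
  even integrable functions, so that signs and bounds can be stated as real inequalities.\<close>

definition cosine_transform :: "(real \<Rightarrow> real) \<Rightarrow> real \<Rightarrow> real" where
  "cosine_transform k \<xi> = (LBINT x. k x * cos (2 * pi * \<xi> * x))"

lemma integrable_mult_bounded:
  fixes k g :: "real \<Rightarrow> real"
  assumes "integrable lborel k" "g \<in> borel_measurable borel" "\<And>x. \<bar>g x\<bar> \<le> 1"
  shows "integrable lborel (\<lambda>x. k x * g x)"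
proof (rule Bochner_Integration.integrable_bound[OF assms(1)])
  show "(\<lambda>x. k x * g x) \<in> borel_measurable lborel"
    using assms by (auto intro!: borel_measurable_times)
  show "AE x in lborel. norm (k x * g x) \<le> norm (k x)"
    using assms(3) by (auto simp: abs_mult mult_left_le)
qed

text \<open>The substitution of \<open>- x\<close> for \<open>x\<close> turns the integral into its
  own negative; this change of variables is valid without integrability.\<close>

lemma integral_even_sin:
  fixes k :: "real \<Rightarrow> real"
  assumes "\<And>x. k (- x) = k x"
  shows "(LBINT x. k x * sin (c * x)) = 0"
  using lborel_integral_real_affine[of "-1" "\<lambda>x. k x * sin (c * x)" 0] assms by simp

text \<open>Splitting the exponential into cosine and sine leaves an odd integrand in the imaginary
  part.\<close>

lemma fourier_transform_even:
  assumes k: "integrable lborel k" and even: "\<And>x. k (- x) = k x"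
  shows "fourier_transform k \<xi> = complex_of_real (cosine_transform k \<xi>)"
proof -
  let ?c = "2 * pi * \<xi>"
  have c: "integrable lborel (\<lambda>x. k x * cos (?c * x))"
    and s: "integrable lborel (\<lambda>x. k x * sin (?c * x))"
    using k by (intro integrable_mult_bounded; simp)+
  have "exp (- 2 * complex_of_real pi * \<i> * complex_of_real \<xi> * complex_of_real x)
      = complex_of_real (cos (?c * x)) - \<i> * complex_of_real (sin (?c * x))" for x
    using cis_conv_exp[of "- (?c * x)"] by (simp add: complex_eq_iff algebra_simps)
  then have "complex_of_real (k x) * exp (- 2 * complex_of_real pi * \<i> * complex_of_real \<xi> * complex_of_real x)
      = complex_of_real (k x * cos (?c * x)) - \<i> * complex_of_real (k x * sin (?c * x))" for x
    by (simp only: of_real_mult) (simp only: algebra_simps)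
  then have "fourier_transform k \<xi> = (LBINT x. complex_of_real (k x * cos (?c * x))
      - \<i> * complex_of_real (k x * sin (?c * x)))"
    unfolding fourier_transform_def by (simp only:)
  also have "\<dots> = (LBINT x. complex_of_real (k x * cos (?c * x)))
      - \<i> * (LBINT x. complex_of_real (k x * sin (?c * x)))"
    using integrable_of_real[OF c, where 'a=complex] integrable_of_real[OF s, where 'a=complex]
    by (subst Bochner_Integration.integral_diff) auto
  also have "\<dots> = complex_of_real (cosine_transform k \<xi>)"
    using integral_even_sin[of k ?c, OF even]
    unfolding integral_complex_of_real cosine_transform_def by simp
  finally show ?thesis .
qed

text \<open>Convolution theorem for \<open>h\<close> with itself: the character \<open>e\<close>
  satisfies \<open>e x = e t * e (x - t)\<close>, so the double integral factors after Fubini and a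
  translation.\<close>

lemma fourier_transform_convolution:
  assumes h: "integrable lborel h" and w: "\<And>x. w x = (LBINT t. h t * h (x - t))"
  shows "fourier_transform w \<xi> = (fourier_transform h \<xi>)\<^sup>2"
proof -
  define e where "e x = exp (- 2 * complex_of_real pi * \<i> * complex_of_real \<xi> * complex_of_real x)" for x
  have e_add: "e (x + y) = e x * e y" for x y
    unfolding e_def by (simp add: exp_add[symmetric] algebra_simps)
  have norm_e: "norm (e x) = 1" for x
    unfolding e_def by simp
  have [measurable]: "h \<in> borel_measurable borel"
    using borel_measurable_integrable[OF h] by simp
  have [measurable]: "e \<in> borel_measurable borel"
    unfolding e_def by measurable
  define he where "he x = complex_of_real (h x) * e x" for x
  have [measurable]: "he \<in> borel_measurable borel"
    unfolding he_def[abs_def] by measurable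
  have he: "integrable lborel he"
    by (rule Bochner_Integration.integrable_bound[OF h]) (auto simp: he_def norm_mult norm_e)
  have shift_int: "integrable lborel (\<lambda>x. g (x - t))" if "integrable lborel g"
    for t and g :: "real \<Rightarrow> complex"
    using lborel_integrable_real_affine[OF that, of 1 "- t"] by simp
  have shift: "(LBINT x. g (x - t)) = (LBINT x. g x)"
    for t and g :: "real \<Rightarrow> 'b :: {banach, second_countable_topology}"
    using lborel_integral_real_affine[of 1 g "- t"] by simp
  \<comment> \<open>Joint integrability comes from the iterated integral of norms: by translation
    invariance the inner one is \<open>norm (he t)\<close> times a constant.\<close>
  have prod: "integrable (lborel \<Otimes>\<^sub>M lborel) (\<lambda>(t, x). he t * he (x - t))"
  proof (rule lborel_pair.Fubini_integrable)
    show "(\<lambda>(t, x). he t * he (x - t)) \<in> borel_measurable (lborel \<Otimes>\<^sub>M lborel)"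
      by measurable
    have "(LBINT x. norm (he t * he (x - t))) = norm (he t) * (LBINT x. norm (he x))" for t
      using shift[of "\<lambda>x. norm (he x)" t] by (simp add: norm_mult)
    then show "integrable lborel (\<lambda>t. LBINT x. norm (case (t, x) of (t, x) \<Rightarrow> he t * he (x - t)))"
      using he by simp
    show "AE t in lborel. integrable lborel (\<lambda>x. case (t, x) of (t, x) \<Rightarrow> he t * he (x - t))"
      using shift_int[OF he] by simp
  qed
  have "fourier_transform w \<xi> = (LBINT x. LBINT t. he t * he (x - t))"
  proof -
    have "complex_of_real (w x) * e x = (LBINT t. he t * he (x - t))" for x
    proof -
      have "complex_of_real (w x) * e x = (LBINT t. complex_of_real (h t * h (x - t)) * e x)"
        unfolding w integral_complex_of_real[symmetric] by simp
      also have "\<dots> = (LBINT t. he t * he (x - t))"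
      proof -
        have "complex_of_real (h t * h (x - t)) * e x = he t * he (x - t)" for t
          using e_add[of t "x - t"] by (simp add: he_def)
        then show ?thesis by (simp only:)
      qed
      finally show ?thesis .
    qed
    then show ?thesis
      unfolding fourier_transform_def e_def[symmetric] by simp
  qed
  also have "\<dots> = (LBINT t. LBINT x. he t * he (x - t))"
    using lborel_pair.Fubini_integral[OF prod] by simp
  also have "\<dots> = (LBINT t. he t) * (LBINT x. he x)"
    using shift[of he] by simp
  finally show ?thesis
    by (simp add: he_def e_def fourier_transform_def power2_eq_square)
qed

text \<open>Evenness of \<open>h\<close> makes its transform real, so the square given by the
  convolution theorem is the square of a real number.\<close>

lemma cosine_transform_doubly_convolved:
  assumes "doubly_convolved w" and int: "integrable lborel w" and even: "\<And>x. w (- x) = w x"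
  shows "0 \<le> cosine_transform w \<xi>"
proof -
  obtain h where h: "\<And>x. h (- x) = h x" "integrable lborel h"
    "\<And>x. w x = (LBINT t. h t * h (x - t))"
    using assms(1) unfolding doubly_convolved_def by blast
  have "complex_of_real (cosine_transform w \<xi>) = complex_of_real ((cosine_transform h \<xi>)\<^sup>2)"
    using fourier_transform_convolution[OF h(2,3), of \<xi>]
      fourier_transform_even[OF h(2,1), of \<xi>] fourier_transform_even[OF int even, of \<xi>]
    by simp
  then show ?thesis
    unfolding of_real_eq_iff by simp
qed

lemma cosine_transform_le_one:
  assumes "filter_window w L"
  shows "cosine_transform w \<xi> \<le> 1"
proof -
  have w: "(LBINT x. w x) = 1" "\<And>x. 0 \<le> w x"
    using assms unfolding filter_window_def by auto
  \<comment> \<open>A non-integrable function would have integral 0 by convention, whereas this one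
    has integral 1.\<close>
  then have int: "integrable lborel w"
    using not_integrable_integral_eq by force
  have "cosine_transform w \<xi> \<le> (LBINT x. w x)"
    unfolding cosine_transform_def
    by (intro integral_mono integrable_mult_bounded int) (auto simp: w mult_left_le)
  with w show ?thesis by simp
qed

section \<open>Scaling of the filter\<close>

lemma fourier_transform_scaled_filter:
  assumes "0 < L"
  shows "fourier_transform (scaled_filter w L) \<xi> = fourier_transform w (L * \<xi>)"
  unfolding fourier_transform_def scaled_filter_def
  using assms
  by (subst lborel_integral_real_affine[where c = L and t = 0])
    (auto simp: mult_ac scaleR_conv_of_real)

text \<open>Dividing the mask length by \<open>c\<close> stretches the frequency axis by
  \<open>c\<close>, and all zeros with it. This provides the mask length for the second
  extraction.\<close>

lemma lowest_zero_frequency_scaled_filter: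
  assumes "0 < L" "0 < c" "lowest_zero_frequency (scaled_filter w L) \<nu>"
  shows "lowest_zero_frequency (scaled_filter w (L / c)) (c * \<nu>)"
proof -
  have "fourier_transform (scaled_filter w (L / c)) \<xi> = fourier_transform (scaled_filter w L) (\<xi> / c)"
    for \<xi>
    using assms(1,2) by (simp add: fourier_transform_scaled_filter)
  with assms show ?thesis
    unfolding lowest_zero_frequency_def by (auto simp: field_simps)
qed

lemma filter_window_scaled_filter:
  assumes "filter_window w 1" "0 < L"
  shows "filter_window (scaled_filter w L) L"
proof -
  have w: "\<And>x. 0 \<le> w x" "\<And>x. w (- x) = w x" "continuous_on UNIV w"
    "\<And>x. x \<notin> {-1..1} \<Longrightarrow> w x = 0" "(LBINT x. w x) = 1"
    using assms(1) unfolding filter_window_def by auto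
  have "(LBINT x. scaled_filter w L x) = 1"
    using lborel_integral_real_affine[of "1 / L" w 0] w(5) assms(2)
    by (simp add: scaled_filter_def)
  moreover have "continuous_on UNIV (scaled_filter w L)"
    unfolding scaled_filter_def
    by (intro continuous_intros continuous_on_compose2[OF w(3)]) (use assms(2) in auto)
  moreover have "scaled_filter w L x = 0" if "x \<notin> {-L..L}" for x
  proof -
    have "x / L \<notin> {-1..1}"
      using that assms(2) by (auto simp: field_simps)
    then show ?thesis
      using w(4) by (simp add: scaled_filter_def)
  qed
  ultimately show ?thesis
    using w(1,2) assms(2) unfolding filter_window_def by (auto simp: scaled_filter_def[abs_def])
qed

section \<open>Sifting of two tones\<close>

text \<open>Tones are eigenfunctions of convolution with an even filter: in the addition formula for
  the cosine, the sine part integrates to 0.\<close>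

lemma sift_two_tones:
  assumes "filter_window (scaled_filter w L) L"
  shows "sift w L (\<lambda>x. A * cos (2 * pi * \<mu> * x + \<alpha>) + B * cos (2 * pi * \<nu> * x + \<beta>))
    = (\<lambda>x. (1 - cosine_transform (scaled_filter w L) \<mu>) * A * cos (2 * pi * \<mu> * x + \<alpha>)
         + (1 - cosine_transform (scaled_filter w L) \<nu>) * B * cos (2 * pi * \<nu> * x + \<beta>))"
proof
  fix x
  define k where "k = scaled_filter w L"
  have k: "\<And>x. k (- x) = k x" "\<And>x. x \<notin> {-L..L} \<Longrightarrow> k x = 0" "(LBINT x. k x) = 1"
    using assms unfolding filter_window_def k_def by auto
  then have int: "integrable lborel k"
    using not_integrable_integral_eq by force
  have tone_int: "integrable lborel (\<lambda>t. k t * cos (2 * pi * \<xi> * (x + t) + \<theta>))" for \<xi> \<theta>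
    by (intro integrable_mult_bounded int) auto
  have tone: "(LBINT t. k t * cos (2 * pi * \<xi> * (x + t) + \<theta>))
      = cosine_transform k \<xi> * cos (2 * pi * \<xi> * x + \<theta>)" for \<xi> \<theta>
  proof -
    let ?p = "2 * pi * \<xi> * x + \<theta>" and ?c = "2 * pi * \<xi>"
    have "?c * (x + t) + \<theta> = ?p + ?c * t" for t
      by (simp add: algebra_simps)
    then have "(LBINT t. k t * cos (?c * (x + t) + \<theta>))
        = (LBINT t. cos ?p * (k t * cos (?c * t)) - sin ?p * (k t * sin (?c * t)))"
      by (simp only: cos_add) (simp add: algebra_simps)
    also have "\<dots> = cos ?p * (LBINT t. k t * cos (?c * t)) - sin ?p * (LBINT t. k t * sin (?c * t))"
      by (subst Bochner_Integration.integral_diff)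
        (auto intro!: integrable_mult_right integrable_mult_bounded int)
    finally show ?thesis
      using integral_even_sin[of k ?c, OF k(1)] by (simp add: cosine_transform_def)
  qed
  let ?g = "\<lambda>x. A * cos (2 * pi * \<mu> * x + \<alpha>) + B * cos (2 * pi * \<nu> * x + \<beta>)"
  \<comment> \<open>The filter vanishes outside the mask, so the integral may run over the whole
    line.\<close>
  have "(LBINT t:{-L..L}. ?g (x + t) * k t) = (LBINT t. ?g (x + t) * k t)"
    unfolding set_lebesgue_integral_def
    by (rule Bochner_Integration.integral_cong) (use k(2) in \<open>auto simp: indicator_def\<close>)
  also have "\<dots> = (LBINT t. A * (k t * cos (2 * pi * \<mu> * (x + t) + \<alpha>))
      + B * (k t * cos (2 * pi * \<nu> * (x + t) + \<beta>)))"
    by (simp add: algebra_simps)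
  also have "\<dots> = A * (cosine_transform k \<mu> * cos (2 * pi * \<mu> * x + \<alpha>))
      + B * (cosine_transform k \<nu> * cos (2 * pi * \<nu> * x + \<beta>))"
    using tone_int by (subst Bochner_Integration.integral_add) (auto simp: tone)
  finally show "sift w L ?g x
      = (1 - cosine_transform (scaled_filter w L) \<mu>) * A * cos (2 * pi * \<mu> * x + \<alpha>)
         + (1 - cosine_transform (scaled_filter w L) \<nu>) * B * cos (2 * pi * \<nu> * x + \<beta>)"
    by (simp add: sift_def k_def algebra_simps)
qed

text \<open>Each sift keeps the amplitude at \<mu> and multiplies the one at \<nu> by
  \<open>q\<close>, where 0 \<le> \<open>q\<close> < 1. Since the cosine is bounded by 1, the decay
  of amplitudes is uniform in \<open>x\<close>.\<close>

lemma has_IMF_two_tones: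
  assumes fw: "filter_window (scaled_filter w L) L"
    and \<mu>: "cosine_transform (scaled_filter w L) \<mu> = 0"
    and \<nu>: "0 < cosine_transform (scaled_filter w L) \<nu>"
  shows "has_IMF w L (\<lambda>x. A * cos (2 * pi * \<mu> * x + \<alpha>) + B * cos (2 * pi * \<nu> * x + \<beta>))
    (\<lambda>x. A * cos (2 * pi * \<mu> * x + \<alpha>))"
proof -
  define q where "q = 1 - cosine_transform (scaled_filter w L) \<nu>"
  \<comment> \<open>Only \<open>B\<close> is abstracted, as it is the only amplitude that changes
    during the iteration.\<close>
  let ?g = "\<lambda>B x. A * cos (2 * pi * \<mu> * x + \<alpha>) + B * cos (2 * pi * \<nu> * x + \<beta>)"
  have q: "\<bar>q\<bar> < 1"
    using \<nu> cosine_transform_le_one[OF fw, of \<nu>] by (simp add: q_def)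
  have iter: "(sift w L ^^ m) (?g B) = ?g (q ^ m * B)" for m
  proof (induction m)
    case (Suc m)
    have "sift w L (?g (q ^ m * B)) = ?g (q ^ Suc m * B)"
      unfolding sift_two_tones[OF fw] \<mu> q_def by (simp add: mult.assoc)
    with Suc show ?case by simp
  qed simp
  have bound: "\<bar>q ^ m * B * cos y\<bar> \<le> \<bar>q ^ m * B\<bar>" for m y
    by (simp add: abs_mult mult_left_le)
  have "(\<lambda>m. q ^ m * B) \<longlonglongrightarrow> 0"
    using q by (intro tendsto_mult_left_zero LIMSEQ_power_zero) simp
  then have "\<forall>\<^sub>F m in sequentially. \<bar>q ^ m * B\<bar> < e" if "0 < e" for e
    using that by (auto dest: tendstoD)
  then have "\<forall>\<^sub>F m in sequentially. \<forall>x\<in>UNIV. \<bar>q ^ m * B * cos (2 * pi * \<nu> * x + \<beta>)\<bar> < e"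
    if "0 < e" for e
    by (rule eventually_mono) (use that in \<open>auto intro: le_less_trans[OF bound]\<close>)
  then show ?thesis
    unfolding has_IMF_def iter uniform_limit_iff dist_real_def by simp
qed

section \<open>Extrema and the outer loop\<close>

text \<open>Ensures that the outer loop does not stop after the first extraction. Points whose phase
  is a multiple of 2 pi are strict maxima or minima, according to the sign of
  \<open>a\<close>.\<close>

lemma not_at_most_one_extremum_LF:
  assumes "a \<noteq> 0" "0 < f"
  shows "\<not> at_most_one_extremum (LF a f \<phi>)"
proof -
  have ext: "local_extremum (LF a f \<phi>) x" if x: "2 * pi * f * x + \<phi> = 2 * pi * of_int n" for x and n :: int
  proof -
    \<comment> \<open>The radius \<open>1 / f\<close> is one period, so no other point within it has
      a phase that is a multiple of 2 pi.\<close>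
    have "cos (2 * pi * f * y + \<phi>) < 1" if "y \<noteq> x" "dist y x < 1 / f" for y
    proof -
      have "cos (2 * pi * f * y + \<phi>) \<noteq> 1"
      proof
        assume "cos (2 * pi * f * y + \<phi>) = 1"
        then obtain m :: int where m: "2 * pi * f * y + \<phi> = of_int m * 2 * pi"
          unfolding cos_one_2pi_int by blast
        then have "2 * pi * (f * (y - x)) = 2 * pi * of_int (m - n)"
          using x by (simp add: algebra_simps)
        then have eq: "f * (y - x) = of_int (m - n)"
          by simp
        have "f * \<bar>y - x\<bar> < 1"
          using that(2) assms(2) by (simp add: dist_real_def field_simps)
        then have "\<bar>f * (y - x)\<bar> < 1"
          using assms(2) by (simp add: abs_mult)
        then have "m - n = 0"
          unfolding eq by linarith
        with eq that(1) assms(2) show False by simp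
      qed
      then show ?thesis
        using cos_le_one[of "2 * pi * f * y + \<phi>"] by linarith
    qed
    then have ev: "\<forall>\<^sub>F y in at x. cos (2 * pi * f * y + \<phi>) < 1"
      unfolding eventually_at using assms(2) by (intro exI[of _ "1 / f"]) auto
    have "LF a f \<phi> x = a"
      unfolding LF_def x by simp
    then show ?thesis
      using ev assms(1) unfolding local_extremum_def
      by (cases "0 < a") (auto simp: LF_def mult_less_cancel_left1 mult_less_cancel_left2
          elim!: eventually_mono)
  qed
  have "local_extremum (LF a f \<phi>) (- \<phi> / (2 * pi * f))"
    "local_extremum (LF a f \<phi>) ((2 * pi - \<phi>) / (2 * pi * f))"
    using ext[of _ 0] ext[of _ 1] assms(2) by simp_all
  moreover have "- \<phi> / (2 * pi * f) \<noteq> (2 * pi - \<phi>) / (2 * pi * f)"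
    using assms(2) by (simp add: divide_simps)
  ultimately show ?thesis
    unfolding at_most_one_extremum_def by blast
qed

text \<open>Accurate selection means placing the first zero at the highest frequency still present:
  first 1, then \<open>f\<close>. The existence clause keeps the claim about all such
  \<open>L'\<close> from being vacuous.\<close>

theorem theorem2:
  fixes w :: "real \<Rightarrow> real" and L a f \<phi> :: real
  assumes "0 < f" and "f < 1"
    and "filter_window w 1"
    and "0 < L"
    and "doubly_convolved (scaled_filter w L)"
    and "lowest_zero_frequency (scaled_filter w L) 1"
  shows "has_IMF w L (two_tone_signal a f \<phi>) HF
    \<and> (\<lambda>x. two_tone_signal a f \<phi> x - HF x) = LF a f \<phi>
    \<and> (\<exists>L'>0. lowest_zero_frequency (scaled_filter w L') f)
    \<and> (\<forall>L'>0. lowest_zero_frequency (scaled_filter w L') f \<longrightarrow>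
          has_IMF w L' (LF a f \<phi>) (LF a f \<phi>)
          \<and> (a \<noteq> 0 \<longrightarrow> IF_run w (two_tone_signal a f \<phi>) [L, L'] [HF, LF a f \<phi>] (\<lambda>x. 0)))"
proof (intro conjI allI impI)
  have fw: "filter_window (scaled_filter w l) l" if "0 < l" for l
    using filter_window_scaled_filter[OF assms(3) that] .
  have even: "scaled_filter w l (- x) = scaled_filter w l x" if "0 < l" for l x
    using fw[OF that] unfolding filter_window_def by blast
  have int: "integrable lborel (scaled_filter w l)" if "0 < l" for l
    using fw[OF that] not_integrable_integral_eq unfolding filter_window_def by force
  have ft: "fourier_transform (scaled_filter w l) \<xi> = 0
      \<longleftrightarrow> cosine_transform (scaled_filter w l) \<xi> = 0" if "0 < l" for l \<xi>
    using fourier_transform_even[OF int[OF that] even[OF that]] by simp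
  have one: "cosine_transform (scaled_filter w L) 1 = 0"
    and "cosine_transform (scaled_filter w L) f \<noteq> 0"
    using assms(1,2,6) ft[OF assms(4)] unfolding lowest_zero_frequency_def by auto
  \<comment> \<open>Below the first zero the transform is nonzero, and double convolution rules out
    a negative value, for which the sifting factor would exceed 1.\<close>
  then have pos: "0 < cosine_transform (scaled_filter w L) f"
    using cosine_transform_doubly_convolved[OF assms(5) int[OF assms(4)] even[OF assms(4)], of f]
    by simp
  show imf1: "has_IMF w L (two_tone_signal a f \<phi>) HF"
    using has_IMF_two_tones[OF fw[OF assms(4)] one pos, of 1 0 a \<phi>]
    by (simp add: two_tone_signal_def[abs_def] HF_def[abs_def])
  show rem: "(\<lambda>x. two_tone_signal a f \<phi> x - HF x) = LF a f \<phi>"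
    by (auto simp: two_tone_signal_def HF_def LF_def)
  show "\<exists>L'>0. lowest_zero_frequency (scaled_filter w L') f"
    using lowest_zero_frequency_scaled_filter[OF assms(4,1,6)] assms(1,4)
    \<comment> \<open>Lengthening the mask from \<open>L\<close> to \<open>L / f\<close> moves the
      first zero from 1 to \<open>f\<close>.\<close>
    by (intro exI[of _ "L / f"]) simp
  fix L' :: real
  assume L': "0 < L'" and low: "lowest_zero_frequency (scaled_filter w L') f"
  have zero: "cosine_transform (scaled_filter w L') f = 0"
    using low ft[OF L'] unfolding lowest_zero_frequency_def by auto
  \<comment> \<open>The single tone is treated as two tones, the second with amplitude 0 and
    frequency 0; there the transform is the total mass 1, hence positive.\<close>
  have "cosine_transform (scaled_filter w L') 0 = 1"
    using fw[OF L'] by (simp add: cosine_transform_def filter_window_def)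
  then show imf2: "has_IMF w L' (LF a f \<phi>) (LF a f \<phi>)"
    using has_IMF_two_tones[OF fw[OF L'] zero, of 0 a \<phi> 0 0] by (simp add: LF_def[abs_def])
  assume "a \<noteq> 0"
  \<comment> \<open>Extrema are strict, so the zero remainder has none and the loop stops.\<close>
  have "at_most_one_extremum (\<lambda>x. 0)"
    by (simp add: at_most_one_extremum_def local_extremum_def)
  then have "IF_run w (LF a f \<phi>) [L'] [LF a f \<phi>] (\<lambda>x. 0)"
    using IF_run.stop[OF L' imf2] by simp
  with not_at_most_one_extremum_LF[OF \<open>a \<noteq> 0\<close> assms(1)]
  show "IF_run w (two_tone_signal a f \<phi>) [L, L'] [HF, LF a f \<phi>] (\<lambda>x. 0)"
    by (intro IF_run.continue[OF assms(4) imf1 rem[symmetric]])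
qed

end
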